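(* Let $s,k\in\mathbb{N}$ and let $p\in\mathbb{N}$ with $p\ge k$. For all $n\in\mathbb{N}'$, $$\binom{n+p+1-k}{2p}_{F_s}=(-y)^{spn}\ast\sum_{j=0}^{p-1}\frac{(-y)^{sj(n-k)}F_{2s(p-j)(n+1-k)}}{\mathcal{P}_{2s(p-j)}\,F_{2s(p-j)}}$$ and $$\binom{n+p-k}{2p-1}_{F_s}=\sum_{j=0}^{p-1}\frac{(-y)^{sj(n-k)}F_{s(2p-1-2j)(n+1-k)}}{\mathcal{R}_{s(2p-1-2j)}\,F_{s(2p-1-2j)}},$$ where $\ast$ is convolution of sequences indexed by $n\ge0$ and, for $j=0,1,\dots,p-1$, $$\mathcal{P}_{2s(p-j)}=\prod_{\substack{i=0\\ i\ne j}}^{p-1}\left((-y)^{sj}L_{2s(p-j)}-(-y)^{si}L_{2s(p-i)}\right),$$ $$\mathcal{R}_{s(2p-1-2j)}=\prod_{\substack{i=0\\ i\ne j}}^{p-1}\left((-y)^{sj}L_{s(2p-1-2j)}-(-y)^{si}L_{s(2p-1-2i)}\right).$$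
   Context: $\mathbb{N}=\{1,2,\dots\}$, $\mathbb{N}'=\mathbb{N}\cup\{0\}$. $x,y$ are indeterminates and we abbreviate $F_n=F_n(x,y)$, $L_n=L_n(x,y)$. The bivariate Fibonacci and Lucas polynomials are given by $F_0=0$, $F_1=1$, $F_{n+2}=xF_{n+1}+yF_n$ and $L_0=2$, $L_1=x$, $L_{n+2}=xL_{n+1}+yL_n$, extended to negative indices by $F_{-n}=-(-y)^{-n}F_n$, $L_{-n}=(-y)^{-n}L_n$ ($n\in\mathbb{N}$). For $n,k\in\mathbb{N}'$ the bivariate $s$-Fibopolynomial is $\binom{n}{k}_{F_s}=\frac{F_{sn}F_{s(n-1)}\cdots F_{s(n-k+1)}}{F_sF_{2s}\cdots F_{ks}}$ (equal to $1$ for $k=0$ and $k=n$, and to $0$ if $k>n$). Convolution: $a_n\ast b_n=\sum_{t=0}^na_tb_{n-t}$, where $a_n,b_n$ denote whole sequences in $n$. Empty products equal $1$. Identities are in $\mathbb{C}(x,y)$. *)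

theory Defs
  imports "HOL-Computational_Algebra.Computational_Algebra"
begin

text \<open>
  The field of rational functions in two indeterminates over the complex numbers, as the
  fraction field of the polynomial ring in \<open>y\<close> over the polynomial ring in \<open>x\<close>.
\<close>
type_synonym ratfun2 = "complex poly poly fract"

definition X :: ratfun2 where "X = Fract [:[:0, 1:]:] 1"

definition Y :: ratfun2 where "Y = Fract [:0, 1:] 1"

fun Fib_nat :: "nat \<Rightarrow> ratfun2" where
  "Fib_nat 0 = 0"
| "Fib_nat (Suc 0) = 1"
| "Fib_nat (Suc (Suc n)) = X * Fib_nat (Suc n) + Y * Fib_nat n"

fun Luc_nat :: "nat \<Rightarrow> ratfun2" where
  "Luc_nat 0 = 2"
| "Luc_nat (Suc 0) = X"
| "Luc_nat (Suc (Suc n)) = X * Luc_nat (Suc n) + Y * Luc_nat n"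

definition F :: "int \<Rightarrow> ratfun2" where
  "F n = (if n \<ge> 0 then Fib_nat (nat n) else - ((- Y) powi n) * Fib_nat (nat (- n)))"

definition L :: "int \<Rightarrow> ratfun2" where
  "L n = (if n \<ge> 0 then Luc_nat (nat n) else (- Y) powi n * Luc_nat (nat (- n)))"

text \<open>
  The factors of the numerator are indexed by integers, so that no truncated subtraction occurs
  when \<open>k > n\<close>. The conventional values for \<open>k = 0\<close>, \<open>k = n\<close> and \<open>k > n\<close> then follow from
  the formula; see the lemmas below.
\<close>
definition fibopoly :: "nat \<Rightarrow> nat \<Rightarrow> nat \<Rightarrow> ratfun2" where
  "fibopoly s n k =
     (\<Prod>i<k. F (int s * (int n - int i))) / (\<Prod>i\<in>{1..k}. F (int i * int s))"

definition conv :: "(nat \<Rightarrow> ratfun2) \<Rightarrow> (nat \<Rightarrow> ratfun2) \<Rightarrow> nat \<Rightarrow> ratfun2" where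
  "conv a b n = (\<Sum>t=0..n. a t * b (n - t))"

text \<open>
  The products \<open>\<P>\<close> and \<open>\<R>\<close> of the statement depend on \<open>s\<close>, \<open>p\<close> and \<open>j\<close> separately, not only on
  the numbers \<open>2s(p - j)\<close> and \<open>s(2p - 1 - 2j)\<close> by which they are conventionally subscripted.
\<close>
definition PP :: "nat \<Rightarrow> nat \<Rightarrow> nat \<Rightarrow> ratfun2" where
  "PP s p j = (\<Prod>i\<in>{0..<p} - {j}.
     (- Y) ^ (s * j) * L (2 * int s * (int p - int j))
     - (- Y) ^ (s * i) * L (2 * int s * (int p - int i)))"

definition RR :: "nat \<Rightarrow> nat \<Rightarrow> nat \<Rightarrow> ratfun2" where
  "RR s p j = (\<Prod>i\<in>{0..<p} - {j}.
     (- Y) ^ (s * j) * L (int s * (2 * int p - 1 - 2 * int j))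
     - (- Y) ^ (s * i) * L (int s * (2 * int p - 1 - 2 * int i)))"

lemma F_minus: "F (- int n) = - ((- Y) powi (- int n)) * F (int n)" if "n > 0"
  using that by (simp add: F_def)

lemma L_minus: "L (- int n) = (- Y) powi (- int n) * L (int n)" if "n > 0"
  using that by (simp add: L_def)

lemma Fib_nat_nonzero: "Fib_nat n \<noteq> 0" if "n > 0"
proof -
  have "\<exists>q m. Fib_nat n = Fract q 1 \<and> poly (poly q 1) 1 = of_nat m \<and> (n > 0 \<longrightarrow> m > 0)"
  proof (induction n rule: Fib_nat.induct)
    case 1
    show ?case
      by (rule exI[of _ 0], rule exI[of _ 0]) (simp add: fract_collapse)
  next
    case 2
    show ?case
      by (rule exI[of _ 1], rule exI[of _ 1]) (simp add: fract_collapse)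
  next
    case (3 n)
    from "3.IH" obtain q m q' m' where q:
      "Fib_nat (Suc n) = Fract q 1" "poly (poly q 1) 1 = of_nat m" "m > 0"
      "Fib_nat n = Fract q' 1" "poly (poly q' 1) 1 = of_nat m'"
      by blast
    have "Fib_nat (Suc (Suc n)) = Fract ([:[:0, 1:]:] * q + [:0, 1:] * q') 1"
      unfolding Fib_nat.simps q X_def Y_def mult_fract by (subst add_fract) simp_all
    moreover have "poly (poly ([:[:0, 1:]:] * q + [:0, 1:] * q') 1) 1 = of_nat (m + m')"
      by (simp only: q poly_add poly_mult poly_pCons poly_0 of_nat_add mult_1_left mult_1_right
          add_0_left add_0_right mult_zero_right poly_1)
    moreover have "Suc (Suc n) > 0 \<longrightarrow> m + m' > 0"
      using q(3) by simp
    ultimately show ?case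
      by (intro exI conjI)
  qed
  then obtain q m where "Fib_nat n = Fract q 1" "poly (poly q 1) 1 = of_nat m" "n > 0 \<longrightarrow> m > 0"
    by (elim exE conjE)
  moreover from this that have "q \<noteq> 0"
    by auto
  ultimately show ?thesis
    by (metis Zero_fract_def eq_fract(1) mult_1_right one_neq_zero)
qed

lemma fibopoly_0: "fibopoly s n 0 = 1"
  by (simp add: fibopoly_def)

lemma fibopoly_eq_0: "fibopoly s n k = 0" if "k > n"
proof -
  have "F (int s * (int n - int n)) = 0"
    by (simp add: F_def)
  then have "(\<Prod>i<k. F (int s * (int n - int i))) = 0"
    using that by (intro prod_zero bexI[of _ n]) auto
  then show ?thesis
    by (simp add: fibopoly_def)
qed

lemma fibopoly_self: "fibopoly s n n = 1" if "s > 0"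
proof -
  have "(\<Prod>i<n. F (int s * (int n - int i))) = (\<Prod>i\<in>{1..n}. F (int i * int s))"
    by (rule prod.reindex_bij_witness[of _ "\<lambda>i. n - i" "\<lambda>i. n - i"])
       (auto simp: of_nat_diff mult.commute)
  moreover have "F (int i * int s) \<noteq> 0" if "i \<ge> 1" for i
  proof -
    have "F (int i * int s) = Fib_nat (i * s)"
      by (simp add: F_def nat_mult_distrib)
    then show ?thesis
      using Fib_nat_nonzero[of "i * s"] that \<open>s > 0\<close> by simp
  qed
  ultimately show ?thesis
    by (simp add: fibopoly_def)
qed

end

theory Submission
  imports Defs "HOL-Algebra.Algebraic_Closure_Type"
begin

text \<open>
  Let \<open>\<alpha>\<close> and \<open>\<beta>\<close> be the roots of \<open>z\<^sup>2 = X z + Y\<close> in the algebraic closure and put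
  \<open>x\<^sub>i = \<alpha> ^ (s (K - i)) \<beta> ^ (s i)\<close> for \<open>i \<le> K\<close>. The Fibopolynomial \<open>fibopoly s N K\<close> is the
  divided difference of \<open>z ^ N\<close> at these nodes, that is, the sum over \<open>i\<close> of
  \<open>x\<^sub>i ^ N\<close> divided by the product of \<open>x\<^sub>i - x\<^sub>j\<close> for \<open>j \<noteq> i\<close>. The product
  \<open>x\<^sub>i x\<^bsub>K-i\<^esub>\<close> does not depend on \<open>i\<close>, so
  \<open>(x\<^sub>i - x\<^sub>j) (x\<^sub>i - x\<^bsub>K-j\<^esub>) = x\<^sub>i ((x\<^sub>i + x\<^bsub>K-i\<^esub>) - (x\<^sub>j + x\<^bsub>K-j\<^esub>))\<close>,
  and \<open>x\<^sub>i + x\<^bsub>K-i\<^esub>\<close> is \<open>(- Y) ^ (s i) L (s (K - 2 i))\<close>. Grouping the terms of \<open>i\<close> and \<open>K - i\<close>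
  gives the formula for odd \<open>K\<close>; for even \<open>K\<close> the middle node is removed first.
\<close>

section \<open>Divided differences of powers\<close>

definition divdiff :: "('i \<Rightarrow> 'a::field) \<Rightarrow> 'i set \<Rightarrow> int \<Rightarrow> 'a" where
  "divdiff x S N = (\<Sum>i\<in>S. x i powi N / (\<Prod>j\<in>S - {i}. x i - x j))"

lemma divdiff_cong:
  "(\<And>i. i \<in> S \<Longrightarrow> x i = x' i) \<Longrightarrow> divdiff x S N = divdiff x' S N"
  unfolding divdiff_def by (intro sum.cong refl arg_cong2[where f = "(/)"] prod.cong) auto

lemma divdiff_reindex:
  assumes "inj_on h S"
  shows "divdiff x (h ` S) N = divdiff (x \<circ> h) S N"
proof -
  have "(\<Prod>j\<in>h ` S - {h i}. x (h i) - x j) = (\<Prod>j\<in>S - {i}. x (h i) - x (h j))"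
    if "i \<in> S" for i
  proof -
    have "h ` S - {h i} = h ` (S - {i})"
      using assms that by (auto dest: inj_onD)
    moreover have "inj_on h (S - {i})"
      using assms by (rule inj_on_subset) auto
    ultimately show ?thesis
      by (simp add: prod.reindex)
  qed
  then show ?thesis
    unfolding divdiff_def by (subst sum.reindex[OF assms]) (simp cong: sum.cong)
qed

text \<open>Homogeneity: numerators have degree \<open>N\<close> in the nodes, denominators have
  \<open>card S - 1\<close> factors.\<close>

lemma divdiff_scale:
  assumes "c \<noteq> 0" "finite S"
  shows "divdiff (\<lambda>i. c * x i) S N = c powi (N - (int (card S) - 1)) * divdiff x S N"
proof -
  have "(c * x i) powi N / (\<Prod>j\<in>S - {i}. c * x i - c * x j) =
      c powi (N - (int (card S) - 1)) * (x i powi N / (\<Prod>j\<in>S - {i}. x i - x j))"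
    if "i \<in> S" for i
  proof -
    have "(\<Prod>j\<in>S - {i}. c * x i - c * x j) = (\<Prod>j\<in>S - {i}. c * (x i - x j))"
      by (simp only: right_diff_distrib)
    also have "\<dots> = c ^ (card S - 1) * (\<Prod>j\<in>S - {i}. x i - x j)"
      using assms that by (simp add: prod.distrib)
    finally have prod: "(\<Prod>j\<in>S - {i}. c * x i - c * x j) =
      c ^ (card S - 1) * (\<Prod>j\<in>S - {i}. x i - x j)" .
    have "card S \<ge> 1"
      using assms that by (auto simp: Suc_le_eq card_gt_0_iff)
    then have card: "int (card S) - 1 = int (card S - 1)"
      by simp
    show ?thesis
      unfolding prod card using assms(1) by (simp add: power_int_diff power_int_mult_distrib)
  qed
  then show ?thesis
    unfolding divdiff_def sum_distrib_left by (intro sum.cong) auto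
qed

text \<open>Raising the exponent and subtracting \<open>x c\<close> times the original multiplies
  the term of \<open>i\<close> by \<open>x i - x c\<close>. This kills the term of \<open>c\<close>
  and cancels the factor of \<open>c\<close> in every other denominator.\<close>

lemma divdiff_remove:
  fixes x :: "'i \<Rightarrow> 'a::field"
  assumes "finite S" "inj_on x S" "c \<in> S" "\<And>i. i \<in> S \<Longrightarrow> x i \<noteq> 0"
  shows "divdiff x (S - {c}) N = divdiff x S (N + 1) - x c * divdiff x S N"
proof -
  have "divdiff x S (N + 1) - x c * divdiff x S N =
      (\<Sum>i\<in>S. x i powi N * (x i - x c) / (\<Prod>j\<in>S - {i}. x i - x j))"
    unfolding divdiff_def sum_distrib_left sum_subtractf[symmetric]
  proof (intro sum.cong refl)
    fix i assume "i \<in> S"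
    then have "x i powi (N + 1) = x i powi N * x i"
      using assms(4) by (simp add: power_int_add)
    then show "x i powi (N + 1) / (\<Prod>j\<in>S - {i}. x i - x j) -
        x c * (x i powi N / (\<Prod>j\<in>S - {i}. x i - x j)) =
        x i powi N * (x i - x c) / (\<Prod>j\<in>S - {i}. x i - x j)"
      by (simp add: right_diff_distrib diff_divide_distrib)
  qed
  also have "\<dots> = (\<Sum>i\<in>S - {c}. x i powi N * (x i - x c) / (\<Prod>j\<in>S - {i}. x i - x j))"
    using assms by (intro sum.mono_neutral_right) auto
  also have "\<dots> = divdiff x (S - {c}) N"
    unfolding divdiff_def
  proof (intro sum.cong refl)
    fix i assume i: "i \<in> S - {c}"
    have "(\<Prod>j\<in>S - {i}. x i - x j) = (x i - x c) * (\<Prod>j\<in>S - {i} - {c}. x i - x j)"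
      using assms i by (intro prod.remove) auto
    moreover have "x i - x c \<noteq> 0"
      using assms i by (auto dest: inj_onD)
    moreover have "S - {i} - {c} = S - {c} - {i}"
      by auto
    ultimately show "x i powi N * (x i - x c) / (\<Prod>j\<in>S - {i}. x i - x j) =
        x i powi N / (\<Prod>j\<in>S - {c} - {i}. x i - x j)"
      by simp
  qed
  finally show ?thesis ..
qed

text \<open>In the denominator of a node \<open>x u\<close>, the two factors of each other pair
  merge into \<open>x u\<close> times a factor common to \<open>u\<close> and its partner. The
  resulting power of \<open>x u\<close> lowers the exponent by \<open>card T - 1\<close>; the
  leftover factor \<open>x i - x (r i)\<close> changes sign between partners, hence the difference
  in the numerator.\<close>

lemma divdiff_pairs:
  fixes x :: "'i \<Rightarrow> 'a::field"
  assumes "finite T" "inj_on r T" "T \<inter> r ` T = {}"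
    and "d \<noteq> 0" and d: "\<And>i. i \<in> T \<Longrightarrow> x i * x (r i) = d"
  shows "divdiff x (T \<union> r ` T) N =
    (\<Sum>i\<in>T. (x i powi (N + 1 - int (card T)) - x (r i) powi (N + 1 - int (card T))) /
      ((\<Prod>j\<in>T - {i}. x i + x (r i) - (x j + x (r j))) * (x i - x (r i))))"
    (is "_ = (\<Sum>i\<in>T. (?e i - ?e (r i)) / (?P i * _))")
proof -
  have nz: "x i \<noteq> 0" "x (r i) \<noteq> 0" if "i \<in> T" for i
    using d[OF that] \<open>d \<noteq> 0\<close> by auto
  \<comment> \<open>The constant term of the expanded product is \<open>d\<close>, which is
    \<open>x u\<close> times its partner, so \<open>x u\<close> factors out.\<close>
  have factor: "(x u - x j) * (x u - x (r j)) = x u * (x i + x (r i) - (x j + x (r j)))"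
    if "i \<in> T" "j \<in> T" "u = i \<or> u = r i" for i j u
  proof -
    have "x j * x (r j) = x i * x (r i)"
      using d that by simp
    then show ?thesis
      using that(3) by (auto simp: algebra_simps)
  qed
  have "(\<Prod>j\<in>T - {i}. (x u - x j) * (x u - x (r j))) = x u ^ (card T - 1) * ?P i"
    if "i \<in> T" "u = i \<or> u = r i" for i u
  proof -
    have "(\<Prod>j\<in>T - {i}. (x u - x j) * (x u - x (r j))) =
        (\<Prod>j\<in>T - {i}. x u * (x i + x (r i) - (x j + x (r j))))"
      using that by (intro prod.cong refl factor) auto
    then show ?thesis
      using assms that by (simp add: prod.distrib)
  qed
  note pairs = this
  have exponent: "y powi N / (y ^ (card T - 1) * z) = y powi (N + 1 - int (card T)) / z"
    if "y \<noteq> 0" "i \<in> T" for i and y z :: 'a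
  proof -
    have "card T \<ge> 1"
      using assms that by (auto simp: Suc_le_eq card_gt_0_iff)
    then have e: "N + 1 - int (card T) = N - int (card T - 1)"
      by simp
    show ?thesis
      unfolding e using that by (simp add: power_int_diff)
  qed
  have 1: "x i powi N / (\<Prod>j\<in>T \<union> r ` T - {i}. x i - x j) = ?e i / (?P i * (x i - x (r i)))"
    if i: "i \<in> T" for i
  proof -
    have "T \<union> r ` T - {i} = (T - {i}) \<union> r ` T" "(T - {i}) \<inter> r ` T = {}"
      using assms i by auto
    then have "(\<Prod>j\<in>T \<union> r ` T - {i}. x i - x j) =
        (\<Prod>j\<in>T - {i}. x i - x j) * (\<Prod>j\<in>T. x i - x (r j))"
      using assms by (simp add: prod.union_disjoint prod.reindex)
    also have "(\<Prod>j\<in>T. x i - x (r j)) = (x i - x (r i)) * (\<Prod>j\<in>T - {i}. x i - x (r j))"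
      using assms i by (intro prod.remove)
    finally have "(\<Prod>j\<in>T \<union> r ` T - {i}. x i - x j) =
        x i ^ (card T - 1) * (?P i * (x i - x (r i)))"
      using pairs[of i i] i by (simp add: prod.distrib mult_ac)
    then show ?thesis
      using exponent nz i by simp
  qed
  have 2: "x (r i) powi N / (\<Prod>j\<in>T \<union> r ` T - {r i}. x (r i) - x j) =
      - ?e (r i) / (?P i * (x i - x (r i)))"
    if i: "i \<in> T" for i
  proof -
    have inj: "inj_on r (T - {i})"
      using assms(2) by (rule inj_on_subset) auto
    have "T \<union> r ` T - {r i} = T \<union> r ` (T - {i})" "T \<inter> r ` (T - {i}) = {}"
      using assms i by (auto dest: inj_onD)
    then have "(\<Prod>j\<in>T \<union> r ` T - {r i}. x (r i) - x j) =
        (\<Prod>j\<in>T. x (r i) - x j) * (\<Prod>j\<in>T - {i}. x (r i) - x (r j))"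
      using assms inj by (simp add: prod.union_disjoint prod.reindex)
    also have "(\<Prod>j\<in>T. x (r i) - x j) = (x (r i) - x i) * (\<Prod>j\<in>T - {i}. x (r i) - x j)"
      using assms i by (intro prod.remove)
    finally have "(\<Prod>j\<in>T \<union> r ` T - {r i}. x (r i) - x j) =
        x (r i) ^ (card T - 1) * (?P i * (x (r i) - x i))"
      using pairs[of i "r i"] i by (simp add: prod.distrib mult_ac)
    then have "x (r i) powi N / (\<Prod>j\<in>T \<union> r ` T - {r i}. x (r i) - x j) =
        ?e (r i) / (?P i * (x (r i) - x i))"
      using exponent nz i by simp
    also have "?P i * (x (r i) - x i) = - (?P i * (x i - x (r i)))"
      by (simp add: algebra_simps)
    finally show ?thesis
      by simp
  qed
  have "divdiff x (T \<union> r ` T) N =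
      (\<Sum>i\<in>T. x i powi N / (\<Prod>j\<in>T \<union> r ` T - {i}. x i - x j)) +
      (\<Sum>i\<in>T. x (r i) powi N / (\<Prod>j\<in>T \<union> r ` T - {r i}. x (r i) - x j))"
    unfolding divdiff_def using assms by (simp add: sum.union_disjoint sum.reindex)
  also have "\<dots> = (\<Sum>i\<in>T. ?e i / (?P i * (x i - x (r i))) + - ?e (r i) / (?P i * (x i - x (r i))))"
    unfolding sum.distrib by (intro arg_cong2[where f = "(+)"] sum.cong refl 1 2)
  finally show ?thesis
    by (simp add: diff_divide_distrib)
qed

section \<open>Nodes in geometric progression\<close>

lemma geometric_nodes_inj:
  fixes a b :: "'a::field"
  assumes "a \<noteq> 0" "b \<noteq> 0" and ne: "\<And>i. i > 0 \<Longrightarrow> a ^ i \<noteq> b ^ i"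
  shows "inj_on (\<lambda>i. a ^ (K - i) * b ^ i) {..K}"
proof (rule linorder_inj_onI)
  fix i j :: nat assume ij: "i < j" "i \<in> {..K}" "j \<in> {..K}"
  then have "K - i = (K - j) + (j - i)"
    by auto
  then have "a ^ (K - i) * b ^ i = a ^ (K - j) * b ^ i * a ^ (j - i)"
    by (simp only: power_add mult_ac)
  moreover have "a ^ (K - j) * b ^ j = a ^ (K - j) * b ^ i * b ^ (j - i)"
    using ij by (simp add: mult.assoc flip: power_add)
  ultimately show "a ^ (K - i) * b ^ i \<noteq> a ^ (K - j) * b ^ j"
    using assms ij by simp
qed auto

text \<open>
  Removing the node \<open>b ^ (K + 1)\<close>, respectively \<open>a ^ (K + 1)\<close>, from the nodes for \<open>K + 1\<close> leaves
  the nodes for \<open>K\<close> multiplied by \<open>a\<close>, respectively \<open>b\<close>. Comparing the two recurrences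
  gives the quotient of consecutive divided differences.
\<close>
lemma divdiff_geometric_nodes:
  fixes a b :: "'a::field"
  assumes "a \<noteq> 0" "b \<noteq> 0" and ne: "\<And>i. i > 0 \<Longrightarrow> a ^ i \<noteq> b ^ i"
  shows "divdiff (\<lambda>i. a ^ (K - i) * b ^ i) {..K} N =
    (\<Prod>i<K. a powi (N - int i) - b powi (N - int i)) / (\<Prod>i\<in>{1..K}. a ^ i - b ^ i)"
proof (induction K)
  case 0
  show ?case
    by (simp add: divdiff_def)
next
  case (Suc K)
  let ?x = "\<lambda>i. a ^ (K - i) * b ^ i"
  let ?X = "\<lambda>i. a ^ (Suc K - i) * b ^ i"
  let ?D = "divdiff ?X {..Suc K}"
  have "{..Suc K} - {Suc K} = {..K}"
    by auto
  then have "?D (N + 1) - b ^ Suc K * ?D N = divdiff ?X {..K} N"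
    using divdiff_remove[of "{..Suc K}" ?X "Suc K" N] geometric_nodes_inj[OF assms, of "Suc K"] assms
    by simp
  also have "\<dots> = divdiff (\<lambda>i. a * ?x i) {..K} N"
    by (intro divdiff_cong) (auto simp: Suc_diff_le)
  also have "\<dots> = a powi (N - int K) * divdiff ?x {..K} N"
    using divdiff_scale[of a "{..K}" ?x N] assms by simp
  finally have A: "?D (N + 1) - b ^ Suc K * ?D N = a powi (N - int K) * divdiff ?x {..K} N" .
  have "{..Suc K} - {0} = Suc ` {..K}"
    by (metis atMost_Suc_eq_insert_0 Diff_insert_absorb imageE nat.distinct(1))
  then have "?D (N + 1) - a ^ Suc K * ?D N = divdiff (?X \<circ> Suc) {..K} N"
    using divdiff_remove[of "{..Suc K}" ?X 0 N] geometric_nodes_inj[OF assms, of "Suc K"] assms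
      divdiff_reindex[of Suc "{..K}" ?X N]
    by simp
  also have "\<dots> = divdiff (\<lambda>i. b * ?x i) {..K} N"
    by (intro divdiff_cong) (auto simp: mult_ac)
  also have "\<dots> = b powi (N - int K) * divdiff ?x {..K} N"
    using divdiff_scale[of b "{..K}" ?x N] assms by simp
  finally have B: "?D (N + 1) - a ^ Suc K * ?D N = b powi (N - int K) * divdiff ?x {..K} N" .
  \<comment> \<open>The difference of the two recurrences eliminates
    \<open>?D (N + 1)\<close>.\<close>
  have "(a ^ Suc K - b ^ Suc K) * ?D N =
      (?D (N + 1) - b ^ Suc K * ?D N) - (?D (N + 1) - a ^ Suc K * ?D N)"
    by (simp only: algebra_simps)
  also have "\<dots> = (a powi (N - int K) - b powi (N - int K)) * divdiff ?x {..K} N"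
    unfolding A B by (simp only: left_diff_distrib)
  finally have step: "?D N = (a powi (N - int K) - b powi (N - int K)) * divdiff ?x {..K} N /
      (a ^ Suc K - b ^ Suc K)"
    using ne[of "Suc K"] by (simp add: field_simps)
  show ?case
    unfolding step Suc.IH by (simp add: mult_ac)
qed

section \<open>Binet formulas in the algebraic closure\<close>

text \<open>This is the discriminant of the characteristic polynomial; it separates
  \<open>al\<close> from \<open>be\<close>.\<close>

lemma discriminant_nonzero: "Defs.X ^ 2 + 4 * Y \<noteq> 0"
proof -
  have "Defs.X ^ 2 + 4 * Y = Defs.X * Defs.X + (Y + Y + Y + Y)"
    by (simp add: power2_eq_square)
  also have "\<dots> = Fraction_Field.Fract [:[:0, 0, 1:], 4:] 1"
    by (simp add: Defs.X_def Y_def)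
  finally show ?thesis
    by (simp add: Zero_fract_def eq_fract)
qed

definition al :: "ratfun2 alg_closure" where
  "al = (SOME z. z ^ 2 = to_ac Defs.X * z + to_ac Y)"

text \<open>Chosen by Vieta, so that \<open>al + be\<close> is \<open>X\<close> by definition and
  only \<open>al\<close> needs a choice.\<close>

definition be :: "ratfun2 alg_closure" where
  "be = to_ac Defs.X - al"

lemma al_squared: "al ^ 2 = to_ac Defs.X * al + to_ac Y"
proof -
  obtain z where "poly [:- to_ac Y, - to_ac Defs.X, 1:] z = 0"
    using alg_closed_imp_poly_has_root[of "[:- to_ac Y, - to_ac Defs.X, 1:]"] by auto
  then have "z ^ 2 = to_ac Defs.X * z + to_ac Y"
    by (simp add: algebra_simps power2_eq_square)
  then show ?thesis
    unfolding al_def by (rule someI)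
qed

lemma al_be: "al * be = - to_ac Y"
  using al_squared by (simp add: be_def algebra_simps power2_eq_square)

lemma be_squared: "be ^ 2 = to_ac Defs.X * be + to_ac Y"
  using al_squared by (simp add: be_def algebra_simps power2_eq_square)

lemma Y_nonzero: "Y \<noteq> 0"
  by (simp add: Y_def Zero_fract_def eq_fract)

lemma al_nonzero: "al \<noteq> 0" and be_nonzero: "be \<noteq> 0"
  using al_be Y_nonzero by auto

lemma al_neq_be: "al \<noteq> be"
proof
  assume "al = be"
  then have "(al - be) ^ 2 = 0"
    by simp
  moreover have "(al - be) ^ 2 = (al + be) ^ 2 - 4 * (al * be)"
    by (simp add: algebra_simps power2_eq_square)
  ultimately have "to_ac (Defs.X ^ 2 + 4 * Y) = 0"
    unfolding al_be by (simp add: be_def)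
  then show False
    using discriminant_nonzero by (simp del: to_ac_add)
qed

lemma root_power_rec:
  fixes z :: "'a::comm_semiring_1"
  assumes "z ^ 2 = u * z + v"
  shows "z ^ Suc (Suc n) = u * z ^ Suc n + v * z ^ n"
proof -
  have "z ^ Suc (Suc n) = z ^ 2 * z ^ n"
    by (simp add: power2_eq_square mult_ac)
  then show ?thesis
    by (simp only: assms) (simp add: algebra_simps)
qed

text \<open>Binet's formula: powers of both roots obey the recurrence, and the initial values
  agree.\<close>

lemma to_ac_Fib_nat: "to_ac (Fib_nat n) = (al ^ n - be ^ n) / (al - be)"
proof (induction n rule: Fib_nat.induct)
  case (3 n)
  then show ?case
    unfolding Fib_nat.simps to_ac_add to_ac_mult 3
      root_power_rec[OF al_squared] root_power_rec[OF be_squared]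
    by (simp add: diff_divide_distrib add_divide_distrib algebra_simps)
qed (use al_neq_be in auto)

lemma to_ac_Luc_nat: "to_ac (Luc_nat n) = al ^ n + be ^ n"
proof (induction n rule: Luc_nat.induct)
  case (3 n)
  then show ?case
    unfolding Luc_nat.simps to_ac_add to_ac_mult 3
      root_power_rec[OF al_squared] root_power_rec[OF be_squared]
    by (simp add: algebra_simps)
qed (auto simp: be_def)

text \<open>The convention for negative indices is exactly what keeps Binet's formula valid, since
  \<open>- Y\<close> becomes \<open>al * be\<close>.\<close>

lemma to_ac_F: "to_ac (F n) = (al powi n - be powi n) / (al - be)"
proof (cases "n \<ge> 0")
  case True
  then show ?thesis
    by (simp add: F_def to_ac_Fib_nat power_int_def)
next
  case False
  define m where "m = nat (- n)"
  then have n: "n = - int m" and "m > 0"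
    using False by auto
  then have "F n = - (inverse ((- Y) ^ m)) * Fib_nat m"
    by (simp add: F_def power_int_minus)
  then have "to_ac (F n) = - (inverse ((al * be) ^ m)) * ((al ^ m - be ^ m) / (al - be))"
    by (simp add: to_ac_Fib_nat al_be)
  also have "\<dots> = (inverse (al ^ m) - inverse (be ^ m)) / (al - be)"
    using al_nonzero be_nonzero al_neq_be by (simp add: field_simps power_mult_distrib)
  finally show ?thesis
    by (simp add: n power_int_minus)
qed

lemma to_ac_L: "to_ac (L (int n)) = al ^ n + be ^ n"
  by (simp add: L_def to_ac_Luc_nat)

lemma to_ac_power_int: "to_ac (z powi n) = to_ac z powi n"
  by (simp add: power_int_def)

text \<open>By Binet, equality would make a Fibonacci polynomial of positive index vanish. This
  gives distinct nodes and nonzero denominators.\<close>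

lemma al_be_power_neq: "al ^ n \<noteq> be ^ n" if "n > 0"
proof
  assume "al ^ n = be ^ n"
  then have "to_ac (Fib_nat n) = 0"
    by (simp add: to_ac_Fib_nat)
  then show False
    using Fib_nat_nonzero[OF that] by simp
qed

section \<open>The nodes of the Fibopolynomials and their pairs\<close>

definition node :: "nat \<Rightarrow> nat \<Rightarrow> nat \<Rightarrow> ratfun2 alg_closure" where
  "node s K i = (al ^ s) ^ (K - i) * (be ^ s) ^ i"

lemma node_nonzero [simp]: "node s K i \<noteq> 0"
  by (simp add: node_def al_nonzero be_nonzero)

lemma node_inj: "inj_on (node s K) {..K}" if "s > 0"
  unfolding node_def using that
  by (intro geometric_nodes_inj)
    (simp_all add: al_nonzero be_nonzero al_be_power_neq flip: power_mult)

text \<open>Supplies the constant \<open>d\<close> of \<open>divdiff_pairs\<close> for the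
  reflection \<open>i\<close> to \<open>K - i\<close>.\<close>

lemma node_mult: "node s K i * node s K (K - i) = (- to_ac Y) ^ (s * K)" if "i \<le> K"
proof -
  have "node s K i * node s K (K - i) =
      ((al ^ s) ^ (K - i) * (al ^ s) ^ i) * ((be ^ s) ^ i * (be ^ s) ^ (K - i))"
    using that by (simp add: node_def mult_ac)
  also have "\<dots> = (al * be) ^ (s * K)"
    using that by (simp add: power_mult power_mult_distrib flip: power_add)
  finally show ?thesis
    by (simp add: al_be)
qed

text \<open>Pulling out \<open>(al * be) ^ (s * i)\<close> leaves a pure power of one root, and
  reflection swaps the roots. Hence sums of partners give Lucas and differences give Fibonacci
  polynomials.\<close>

lemma node_eq:
  assumes "2 * i \<le> K"
  shows "node s K i = (- to_ac Y) ^ (s * i) * al ^ (s * (K - 2 * i))"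
    and "node s K (K - i) = (- to_ac Y) ^ (s * i) * be ^ (s * (K - 2 * i))"
proof -
  have K: "K - i = i + (K - 2 * i)" "K - (K - i) = i"
    using assms by auto
  show "node s K i = (- to_ac Y) ^ (s * i) * al ^ (s * (K - 2 * i))"
    unfolding node_def K by (simp add: power_add power_mult power_mult_distrib flip: al_be)
  show "node s K (K - i) = (- to_ac Y) ^ (s * i) * be ^ (s * (K - 2 * i))"
    unfolding node_def K(2) unfolding K(1)
    by (simp add: power_add power_mult power_mult_distrib flip: al_be)
qed

text \<open>By Binet, numerator and denominator each carry \<open>K\<close> divisors
  \<open>al - be\<close>, which cancel.\<close>

lemma to_ac_fibopoly:
  assumes "s > 0"
  shows "to_ac (fibopoly s n K) = divdiff (node s K) {..K} (int n)"
proof -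
  let ?a = "al ^ s" and ?b = "be ^ s"
  have num: "to_ac (F (int s * (int n - int i))) =
      (?a powi (int n - int i) - ?b powi (int n - int i)) / (al - be)" for i
    by (simp add: to_ac_F power_int_mult)
  have den: "to_ac (F (int i * int s)) = (?a ^ i - ?b ^ i) / (al - be)" for i
    using to_ac_F[of "int i * int s"] by (simp add: mult.commute[of i s] power_mult flip: of_nat_mult)
  have "to_ac (fibopoly s n K) =
      (\<Prod>i<K. (?a powi (int n - int i) - ?b powi (int n - int i)) / (al - be)) /
      (\<Prod>i\<in>{1..K}. (?a ^ i - ?b ^ i) / (al - be))"
    by (simp add: fibopoly_def to_ac_prod num den)
  also have "\<dots> = (\<Prod>i<K. ?a powi (int n - int i) - ?b powi (int n - int i)) /
      (\<Prod>i\<in>{1..K}. ?a ^ i - ?b ^ i)"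
    using al_neq_be by (simp add: prod_dividef)
  also have "\<dots> = divdiff (node s K) {..K} (int n)"
    unfolding node_def using assms
    by (intro divdiff_geometric_nodes[symmetric])
      (simp_all add: al_nonzero be_nonzero al_be_power_neq flip: power_mult)
  finally show ?thesis .
qed

text \<open>
  The inner sum of the first identity is the case \<open>K = 2 * p\<close>, the sum of the second one the
  case \<open>K = 2 * p - 1\<close>, with \<open>M = n + 1 - k\<close> in both.
\<close>
definition pair_sum :: "nat \<Rightarrow> nat \<Rightarrow> nat \<Rightarrow> int \<Rightarrow> ratfun2" where
  "pair_sum s K p M = (\<Sum>j<p. (- Y) powi (int s * int j * (M - 1)) * F (int s * int (K - 2 * j) * M) /
     ((\<Prod>i\<in>{..<p} - {j}. (- Y) ^ (s * j) * L (int s * int (K - 2 * j))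
         - (- Y) ^ (s * i) * L (int s * int (K - 2 * i)))
       * F (int s * int (K - 2 * j))))"

text \<open>The bound on \<open>p\<close> keeps the first \<open>p\<close> indices disjoint from
  their reflections.\<close>

lemma divdiff_node_pairs:
  assumes "2 * p \<le> Suc K"
  shows "divdiff (node s K) ({..<p} \<union> (\<lambda>i. K - i) ` {..<p}) N =
    to_ac (pair_sum s K p (N + 1 - int p))"
proof -
  let ?M = "N + 1 - int p" and ?q = "- to_ac Y"
  have q0: "?q \<noteq> 0"
    by (simp add: Y_nonzero)
  have lucas: "node s K i + node s K (K - i) =
      to_ac ((- Y) ^ (s * i) * L (int s * int (K - 2 * i)))" if "i < p" for i
  proof -
    have "2 * i \<le> K"
      using that assms by simp
    then show ?thesis
      using node_eq[of i K s] to_ac_L[of "s * (K - 2 * i)"] by (simp add: distrib_left)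
  qed
  have fib: "(node s K i powi ?M - node s K (K - i) powi ?M) / (node s K i - node s K (K - i)) =
      to_ac ((- Y) powi (int s * int i * (?M - 1)) * F (int s * int (K - 2 * i) * ?M) /
        F (int s * int (K - 2 * i)))" if "i < p" for i
  proof -
    define e where "e = s * (K - 2 * i)"
    have "2 * i \<le> K"
      using that assms by simp
    note nodes = node_eq[OF this, of s, folded e_def]
    \<comment> \<open>One factor \<open>?q ^ (s * i)\<close> is split off to cancel against the
      denominator, hence \<open>?M - 1\<close> in the exponent.\<close>
    have "?q powi (int (s * i) * ?M) = ?q powi (int (s * i) * (?M - 1) + int (s * i))"
      by (simp add: algebra_simps)
    also have "\<dots> = ?q powi (int (s * i) * (?M - 1)) * ?q ^ (s * i)"
      using q0 by (subst power_int_add) (simp_all del: of_nat_mult)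
    finally have q: "(?q ^ (s * i)) powi ?M = ?q powi (int (s * i) * (?M - 1)) * ?q ^ (s * i)"
      by (simp only: power_int_mult power_int_of_nat)
    have "to_ac ((- Y) powi (int s * int i * (?M - 1)) * F (int s * int (K - 2 * i) * ?M) /
        F (int s * int (K - 2 * i))) =
        ?q powi (int (s * i) * (?M - 1)) *
          ((al ^ e) powi ?M - (be ^ e) powi ?M) / (al ^ e - be ^ e)"
      using al_neq_be to_ac_F[of "int e * ?M"] to_ac_F[of "int e"]
      by (simp add: to_ac_power_int e_def power_int_mult power_mult)
    moreover have "(node s K i powi ?M - node s K (K - i) powi ?M) / (node s K i - node s K (K - i)) =
        ((?q ^ (s * i)) powi ?M * ((al ^ e) powi ?M - (be ^ e) powi ?M)) /
        (?q ^ (s * i) * (al ^ e - be ^ e))"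
      unfolding nodes power_int_mult_distrib right_diff_distrib ..
    ultimately show ?thesis
      using q0 by (simp add: q)
  qed
  have "inj_on (\<lambda>i. K - i) {..<p}" "{..<p} \<inter> (\<lambda>i. K - i) ` {..<p} = {}"
    using assms by (auto intro!: inj_onI)
  moreover have "node s K i * node s K (K - i) = ?q ^ (s * K)" if "i \<in> {..<p}" for i
    using that assms by (intro node_mult) auto
  ultimately have "divdiff (node s K) ({..<p} \<union> (\<lambda>i. K - i) ` {..<p}) N =
    (\<Sum>i<p. (node s K i powi ?M - node s K (K - i) powi ?M) /
      ((\<Prod>j\<in>{..<p} - {i}. node s K i + node s K (K - i) - (node s K j + node s K (K - j)))
        * (node s K i - node s K (K - i))))"
    using divdiff_pairs[of "{..<p}" "\<lambda>i. K - i" "?q ^ (s * K)" "node s K" N] q0 by simp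
  also have "\<dots> = to_ac (pair_sum s K p ?M)"
    unfolding pair_sum_def to_ac_sum
  proof (intro sum.cong refl)
    fix i assume "i \<in> {..<p}"
    then have i: "i < p"
      by simp
    have prod: "(\<Prod>j\<in>{..<p} - {i}. node s K i + node s K (K - i) - (node s K j + node s K (K - j))) =
        to_ac (\<Prod>j\<in>{..<p} - {i}. (- Y) ^ (s * i) * L (int s * int (K - 2 * i))
         - (- Y) ^ (s * j) * L (int s * int (K - 2 * j)))" (is "?lhs = to_ac ?rhs")
      unfolding to_ac_prod to_ac_diff by (intro prod.cong refl) (simp add: lucas i)
    have div: "u / (v * w) = u / w / v" for u v w :: "ratfun2 alg_closure"
      by simp
    have div': "u / (v * w) = u / w / v" for u v w :: ratfun2
      by simp
    show "(node s K i powi ?M - node s K (K - i) powi ?M) /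
        (?lhs * (node s K i - node s K (K - i))) =
        to_ac ((- Y) powi (int s * int i * (?M - 1)) * F (int s * int (K - 2 * i) * ?M) /
          (?rhs * F (int s * int (K - 2 * i))))"
      unfolding prod div div' fib[OF i] to_ac_divide ..
  qed
  finally show ?thesis .
qed

section \<open>Odd and even lower index\<close>

text \<open>There are \<open>2 * p\<close> nodes, so the reflection has no fixed index and the pairs
  exhaust them.\<close>

lemma fibopoly_odd:
  assumes "s > 0" "p > 0"
  shows "fibopoly s n (2 * p - 1) = pair_sum s (2 * p - 1) p (int n + 1 - int p)"
proof -
  have "{..2 * p - 1} = {..<p} \<union> (\<lambda>i. 2 * p - 1 - i) ` {..<p}"
  proof (intro equalityI subsetI)
    fix i assume "i \<in> {..2 * p - 1}"
    then have "i < p \<or> 2 * p - 1 - i < p \<and> i = 2 * p - 1 - (2 * p - 1 - i)"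
      using assms by auto
    then show "i \<in> {..<p} \<union> (\<lambda>i. 2 * p - 1 - i) ` {..<p}"
      by blast
  qed auto
  then have "to_ac (fibopoly s n (2 * p - 1)) = to_ac (pair_sum s (2 * p - 1) p (int n + 1 - int p))"
    using to_ac_fibopoly[OF assms(1), of n "2 * p - 1"] divdiff_node_pairs[of p "2 * p - 1" s "int n"]
    by simp
  then show ?thesis
    by simp
qed

text \<open>
  The unpaired middle node is \<open>(- Y) ^ (s * p)\<close>; removing it yields a recurrence in \<open>n\<close>
  instead of a closed form, which is where the convolution comes from.
\<close>
lemma fibopoly_even_rec:
  assumes "s > 0"
  shows "fibopoly s (Suc n) (2 * p) =
    (- Y) ^ (s * p) * fibopoly s n (2 * p) + pair_sum s (2 * p) p (int n + 1 - int p)"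
proof -
  have "{..2 * p} - {p} = {..<p} \<union> (\<lambda>i. 2 * p - i) ` {..<p}"
  proof (intro equalityI subsetI)
    fix i assume "i \<in> {..2 * p} - {p}"
    then have "i < p \<or> 2 * p - i < p \<and> i = 2 * p - (2 * p - i)"
      by auto
    then show "i \<in> {..<p} \<union> (\<lambda>i. 2 * p - i) ` {..<p}"
      by blast
  qed auto
  moreover have "node s (2 * p) p = to_ac ((- Y) ^ (s * p))"
    using node_eq(1)[of p "2 * p" s] by simp
  ultimately have "to_ac (pair_sum s (2 * p) p (int n + 1 - int p)) =
      divdiff (node s (2 * p)) {..2 * p} (int (Suc n)) -
      to_ac ((- Y) ^ (s * p)) * divdiff (node s (2 * p)) {..2 * p} (int n)"
    using divdiff_remove[of "{..2 * p}" "node s (2 * p)" p "int n"] node_inj[OF assms]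
      divdiff_node_pairs[of p "2 * p" s "int n"]
    by (simp add: add.commute Y_nonzero)
  also have "\<dots> = to_ac (fibopoly s (Suc n) (2 * p) - (- Y) ^ (s * p) * fibopoly s n (2 * p))"
    by (simp only: to_ac_fibopoly[OF assms] to_ac_diff to_ac_mult)
  finally have "pair_sum s (2 * p) p (int n + 1 - int p) =
      fibopoly s (Suc n) (2 * p) - (- Y) ^ (s * p) * fibopoly s n (2 * p)"
    by (simp only: to_ac_eq_iff)
  then show ?thesis
    by simp
qed

text \<open>Unrolling the first-order recurrence from a zero initial value leaves only the
  convolution.\<close>

lemma fibopoly_even:
  assumes "s > 0" "p \<ge> k" "k \<ge> 1"
  shows "fibopoly s (n + p + 1 - k) (2 * p) =
    conv (\<lambda>n. (- Y) ^ (s * p * n)) (\<lambda>n. pair_sum s (2 * p) p (int n + 1 - int k)) n"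
proof (induction n)
  case 0
  \<comment> \<open>The initial term \<open>fibopoly s (p - k) (2 * p)\<close> vanishes because
    \<open>p - k < 2 * p\<close>.\<close>
  have "fibopoly s (Suc (p - k)) (2 * p) = pair_sum s (2 * p) p (1 - int k)"
    using fibopoly_even_rec[OF assms(1), of "p - k" p] assms
    by (simp add: fibopoly_eq_0 of_nat_diff)
  then show ?case
    using assms by (simp add: conv_def Suc_diff_le)
next
  case (Suc n)
  let ?q = "\<lambda>n. (- Y) ^ (s * p * n)" and ?A = "\<lambda>n. pair_sum s (2 * p) p (int n + 1 - int k)"
  \<comment> \<open>The term \<open>t = 0\<close> is split off; the others share a factor
    \<open>(- Y) ^ (s * p)\<close>.\<close>
  have "conv ?q ?A (Suc n) = ?A (Suc n) + (- Y) ^ (s * p) * conv ?q ?A n"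
    unfolding conv_def sum_distrib_left
    by (subst sum.atLeast0_atMost_Suc_shift) (simp add: power_add algebra_simps)
  moreover have "fibopoly s (Suc n + p + 1 - k) (2 * p) =
      (- Y) ^ (s * p) * fibopoly s (n + p + 1 - k) (2 * p) + ?A (Suc n)"
    using fibopoly_even_rec[OF assms(1), of "n + p + 1 - k" p] assms
    by (simp add: Suc_diff_le of_nat_diff algebra_simps)
  ultimately show ?case
    using Suc.IH by simp
qed

theorem corollary17:
  fixes s k p :: nat
  assumes "s \<ge> 1" and "k \<ge> 1" and "p \<ge> 1" and "p \<ge> k"
  shows
    "(\<forall>n :: nat. fibopoly s (n + p + 1 - k) (2 * p) =
        conv (\<lambda>n. (- Y) ^ (s * p * n))
             (\<lambda>n. \<Sum>j=0..p-1.
                (- Y) powi (int s * int j * (int n - int k))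
                  * F (2 * int s * (int p - int j) * (int n + 1 - int k))
                / (PP s p j * F (2 * int s * (int p - int j)))) n)
   \<and> (\<forall>n :: nat. fibopoly s (n + p - k) (2 * p - 1) =
        (\<Sum>j=0..p-1.
           (- Y) powi (int s * int j * (int n - int k))
             * F (int s * (2 * int p - 1 - 2 * int j) * (int n + 1 - int k))
           / (RR s p j * F (int s * (2 * int p - 1 - 2 * int j)))))"
proof (intro conjI allI)
  fix n :: nat
  have range: "{0..p - 1} = {..<p}"
    using assms by auto
  have "pair_sum s (2 * p) p (int m + 1 - int k) = (\<Sum>j=0..p-1.
      (- Y) powi (int s * int j * (int m - int k))
        * F (2 * int s * (int p - int j) * (int m + 1 - int k))
      / (PP s p j * F (2 * int s * (int p - int j))))" for m
  proof -
    have "int s * int (2 * p - 2 * j) = 2 * int s * (int p - int j)" if "j < p" for j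
      using that by (simp add: of_nat_diff algebra_simps)
    then show ?thesis
      unfolding pair_sum_def PP_def range
      by (intro sum.cong refl arg_cong2[where f = "(/)"] arg_cong2[where f = "(*)"] prod.cong)
        (auto simp: lessThan_atLeast0 algebra_simps)
  qed
  then show "fibopoly s (n + p + 1 - k) (2 * p) =
      conv (\<lambda>n. (- Y) ^ (s * p * n))
           (\<lambda>n. \<Sum>j=0..p-1.
              (- Y) powi (int s * int j * (int n - int k))
                * F (2 * int s * (int p - int j) * (int n + 1 - int k))
              / (PP s p j * F (2 * int s * (int p - int j)))) n"
    using fibopoly_even[of s k p n] assms by simp
  have "pair_sum s (2 * p - 1) p (int n + 1 - int k) = (\<Sum>j=0..p-1.
      (- Y) powi (int s * int j * (int n - int k))
        * F (int s * (2 * int p - 1 - 2 * int j) * (int n + 1 - int k))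
      / (RR s p j * F (int s * (2 * int p - 1 - 2 * int j))))"
  proof -
    have "int s * int (2 * p - 1 - 2 * j) = int s * (2 * int p - 1 - 2 * int j)" if "j < p" for j
      using that by (simp add: of_nat_diff algebra_simps)
    then show ?thesis
      unfolding pair_sum_def RR_def range
      by (intro sum.cong refl arg_cong2[where f = "(/)"] arg_cong2[where f = "(*)"] prod.cong)
        (auto simp: lessThan_atLeast0 algebra_simps)
  qed
  \<comment> \<open>The shift of the upper index by \<open>p - k\<close> cancels \<open>p\<close> in
    the Fibonacci indices.\<close>
  moreover have "int (n + p - k) + 1 - int p = int n + 1 - int k"
    using assms by (simp add: of_nat_diff)
  moreover have "fibopoly s (n + p - k) (2 * p - 1) =
      pair_sum s (2 * p - 1) p (int (n + p - k) + 1 - int p)"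
    using assms by (intro fibopoly_odd) auto
  ultimately show "fibopoly s (n + p - k) (2 * p - 1) = (\<Sum>j=0..p-1.
      (- Y) powi (int s * int j * (int n - int k))
        * F (int s * (2 * int p - 1 - 2 * int j) * (int n + 1 - int k))
      / (RR s p j * F (int s * (2 * int p - 1 - 2 * int j))))"
    by (simp only:)
qed

end
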